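(* Consider the two emulation procedures with parameter $k$ in the beeping model $BL$ described in the context, applied to a single time step on a graph with $n$ nodes. For any $\varepsilon>0$, any $n>0$ and any $c>2$: 1. if $k=\lceil\log(1/\varepsilon)\rceil$, the procedures are correct for a given node with probability at least $1-\varepsilon$; 2. if $k=\lceil\log(n/\varepsilon)\rceil$, the procedures are correct for all nodes with probability at least $1-\varepsilon$; 3. if $k=\lceil c\log n\rceil$, the procedures are correct for all nodes with probability $1-o(n^{-1})$ (as $n\to\infty$). Here $\log$ is the binary logarithm.
   Context: Beeping model $BL$: the network is a finite simple undirected graph; nodes are anonymous and synchronous; in each slot every node either beeps or listens. A beeping node gets no information about other beeps in that slot; a listening node learns only whether at least one neighbour beeped. Emulation of one slot with collision detection (a single time step). Each node $v$ has previously generated a sequence $s_v\in\{0,1\}^k$ of $k$ independent uniformly random bits, independently of the other nodes. In the time step to be emulated, an arbitrary fixed set of nodes (not depending on the sequences) wishes to beep, and the others wish to listen. The slot is replaced by $k$ sub-phases of two $BL$-slots each. Procedure EmulateB$_{cd}$inBL (run by a node $v$ wishing to beep): in sub-phase $i$, if $s_v[i]=1$ beep in slot 1 and listen in slot 2, otherwise listen in slot 1 and beep in slot 2. It returns $collision$ = true iff a beep was heard in at least one of the sub-phases. It is correct for $v$ if it returns true exactly when at least one neighbour of $v$ also wishes to beep. Procedure EmulateL$_{cd}$inBL (run by a node $v$ wishing to listen): listen in both slots of all sub-phases. It returns $beep$ = true iff a beep was heard in at least one slot, and $collision$ = true iff in at least one sub-phase a beep was heard in both slots. It is correct for $v$ if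 $beep$ is true exactly when at least one neighbour of $v$ wishes to beep, and $collision$ is true exactly when at least two neighbours of $v$ wish to beep. *)

theory Defs
  imports
    "HOL-Probability.Probability"
    "HOL-Library.Landau_Symbols"
    "Graph_Theory.Pair_Digraph"
begin

text \<open>
  A finite simple undirected graph is a \<open>pair_graph\<close>: a finite digraph without
  loops or parallel arcs whose arc relation is symmetric.
\<close>

definition neighbours :: "'v pair_pre_digraph \<Rightarrow> 'v \<Rightarrow> 'v set" where
  "neighbours G v = {u. (v, u) \<in> parcs G}"

datatype action = Beep | Listen

text \<open>
  What a node learns in one slot of the model \<open>BL\<close>: nothing (\<open>None\<close>) if it beeps
  itself; otherwise only whether at least one neighbour beeped.
\<close>

definition BL_feedback :: "'v pair_pre_digraph \<Rightarrow> ('v \<Rightarrow> action) \<Rightarrow> 'v \<Rightarrow> bool option" where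
  "BL_feedback G act v =
     (if act v = Beep then None else Some (\<exists>u\<in>neighbours G v. act u = Beep))"

datatype slot = Slot1 | Slot2

text \<open>
  A procedure consists of the action it takes in each slot of each of the sub-phases
  \<open>0, \<dots>, k - 1\<close>, and of return values computed from the node's own feedback
  \<open>fb i t\<close> in sub-phase \<open>i\<close>, slot \<open>t\<close>. The bit string of a node is a function on
  sub-phases, of which only the values below \<open>k\<close> are relevant.
\<close>

fun emulateB_action :: "(nat \<Rightarrow> bool) \<Rightarrow> nat \<Rightarrow> slot \<Rightarrow> action" where
  "emulateB_action bits i Slot1 = (if bits i then Beep else Listen)"
| "emulateB_action bits i Slot2 = (if bits i then Listen else Beep)"

definition emulateB_collision :: "nat \<Rightarrow> (nat \<Rightarrow> slot \<Rightarrow> bool option) \<Rightarrow> bool" where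
  "emulateB_collision k fb \<longleftrightarrow> (\<exists>i<k. \<exists>t. fb i t = Some True)"

definition emulateL_action :: "nat \<Rightarrow> slot \<Rightarrow> action" where
  "emulateL_action i t = Listen"

definition emulateL_beep :: "nat \<Rightarrow> (nat \<Rightarrow> slot \<Rightarrow> bool option) \<Rightarrow> bool" where
  "emulateL_beep k fb \<longleftrightarrow> (\<exists>i<k. \<exists>t. fb i t = Some True)"

definition emulateL_collision :: "nat \<Rightarrow> (nat \<Rightarrow> slot \<Rightarrow> bool option) \<Rightarrow> bool" where
  "emulateL_collision k fb \<longleftrightarrow> (\<exists>i<k. \<forall>t. fb i t = Some True)"

text \<open>
  Joint execution when the nodes in \<open>B\<close> wish to beep, all other nodes wish to listen,
  and node \<open>v\<close> has generated the bits \<open>s v\<close>.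
\<close>

definition emulation_action ::
  "'v set \<Rightarrow> ('v \<Rightarrow> nat \<Rightarrow> bool) \<Rightarrow> nat \<Rightarrow> slot \<Rightarrow> 'v \<Rightarrow> action" where
  "emulation_action B s i t v =
     (if v \<in> B then emulateB_action (s v) i t else emulateL_action i t)"

definition emulation_feedback ::
  "'v pair_pre_digraph \<Rightarrow> 'v set \<Rightarrow> ('v \<Rightarrow> nat \<Rightarrow> bool) \<Rightarrow> 'v \<Rightarrow> nat \<Rightarrow> slot \<Rightarrow> bool option" where
  "emulation_feedback G B s v i t = BL_feedback G (emulation_action B s i t) v"

definition emulateB_correct ::
  "'v pair_pre_digraph \<Rightarrow> 'v set \<Rightarrow> nat \<Rightarrow> ('v \<Rightarrow> nat \<Rightarrow> bool) \<Rightarrow> 'v \<Rightarrow> bool" where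
  "emulateB_correct G B k s v \<longleftrightarrow>
     (emulateB_collision k (emulation_feedback G B s v) \<longleftrightarrow> (\<exists>u\<in>neighbours G v. u \<in> B))"

definition emulateL_correct ::
  "'v pair_pre_digraph \<Rightarrow> 'v set \<Rightarrow> nat \<Rightarrow> ('v \<Rightarrow> nat \<Rightarrow> bool) \<Rightarrow> 'v \<Rightarrow> bool" where
  "emulateL_correct G B k s v \<longleftrightarrow>
     (emulateL_beep k (emulation_feedback G B s v) \<longleftrightarrow> (\<exists>u\<in>neighbours G v. u \<in> B)) \<and>
     (emulateL_collision k (emulation_feedback G B s v) \<longleftrightarrow> card (neighbours G v \<inter> B) \<ge> 2)"

definition emulation_correct ::
  "'v pair_pre_digraph \<Rightarrow> 'v set \<Rightarrow> nat \<Rightarrow> ('v \<Rightarrow> nat \<Rightarrow> bool) \<Rightarrow> 'v \<Rightarrow> bool" where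
  "emulation_correct G B k s v \<longleftrightarrow>
     (if v \<in> B then emulateB_correct G B k s v else emulateL_correct G B k s v)"

text \<open>
  Every node independently draws \<open>k\<close> independent fair bits. (\<open>Pi_pmf A d p\<close> is the
  product distribution over the finite index set \<open>A\<close>, with constant value \<open>d\<close> off \<open>A\<close>.)
\<close>

definition random_bits :: "nat \<Rightarrow> (nat \<Rightarrow> bool) pmf" where
  "random_bits k = Pi_pmf {..<k} False (\<lambda>_. bernoulli_pmf (1/2))"

definition random_sequences :: "'v pair_pre_digraph \<Rightarrow> nat \<Rightarrow> ('v \<Rightarrow> nat \<Rightarrow> bool) pmf" where
  "random_sequences G k = Pi_pmf (pverts G) (\<lambda>_. False) (\<lambda>_. random_bits k)"

definition prob_correct_at :: "'v pair_pre_digraph \<Rightarrow> 'v set \<Rightarrow> nat \<Rightarrow> 'v \<Rightarrow> real" where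
  "prob_correct_at G B k v =
     measure_pmf.prob (random_sequences G k) {s. emulation_correct G B k s v}"

definition prob_correct_everywhere :: "'v pair_pre_digraph \<Rightarrow> 'v set \<Rightarrow> nat \<Rightarrow> real" where
  "prob_correct_everywhere G B k =
     measure_pmf.prob (random_sequences G k) {s. \<forall>v\<in>pverts G. emulation_correct G B k s v}"

end

theory Submission
  imports Defs "HOL-Real_Asymp.Real_Asymp"
begin

text \<open>
  The bits of a beeping node determine in which slot of a sub-phase it beeps, so the emulation
  at \<open>v\<close> can only fail if two distinct nodes have equal bit strings: \<open>v\<close> itself and a beeping
  neighbour if \<open>v\<close> beeps, two beeping neighbours if \<open>v\<close> listens. The pair can be chosen
  independently of the bits, hence failure has probability at most \<open>1 / 2 ^ k\<close>, and the bounds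
  for all nodes follow by a union bound.
\<close>

section \<open>Probability that two bit strings agree\<close>

lemma prob_random_bits_agree:
  "measure_pmf.prob (random_bits k) {b. \<forall>i<k. b i = a i} = (1/2) ^ k"
proof -
  have "{b. \<forall>i<k. b i = a i} = Pi {..<k} (\<lambda>i. {a i})"
    by auto
  moreover have "measure_pmf.prob (bernoulli_pmf (1/2)) {a i} = 1/2" for i
    by (cases "a i") (simp_all add: measure_pmf_single)
  ultimately show ?thesis
    unfolding random_bits_def by (simp only: measure_Pi_pmf_Pi finite_lessThan) simp
qed

text \<open>Conditioned on the strings of all nodes other than \<open>u\<close>, the string of
  \<open>w\<close> is a fixed target, and the uniform string of \<open>u\<close> hits it in
  \<open>k\<close> independent fair bits.\<close>

lemma prob_random_sequences_agree:
  assumes "finite (pverts G)" "u \<in> pverts G" "u \<noteq> w"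
  shows "measure_pmf.prob (random_sequences G k) {s. \<forall>i<k. s u i = s w i} = (1/2) ^ k"
proof -
  let ?E = "{s. \<forall>i<k. s u i = s w i}"
  define A where "A = pverts G - {u}"
  have A: "finite A" "u \<notin> A" "pverts G = insert u A"
    using assms by (auto simp: A_def)
  \<comment> \<open>Commuting the two draws makes the string of \<open>u\<close> the last one, so
    that \<open>f w\<close> is already known when it is drawn.\<close>
  have "random_sequences G k =
      bind_pmf (Pi_pmf A (\<lambda>_. False) (\<lambda>_. random_bits k))
        (\<lambda>f. map_pmf (\<lambda>y. f(u := y)) (random_bits k))"
    unfolding random_sequences_def A(3) Pi_pmf_insert'[OF A(1,2)]
    by (subst bind_commute_pmf) (simp add: map_pmf_def)
  moreover have "emeasure (map_pmf (\<lambda>y. f(u := y)) (random_bits k)) ?E = ennreal ((1/2) ^ k)"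
    for f :: "'a \<Rightarrow> nat \<Rightarrow> bool"
  proof -
    have "(\<lambda>y. f(u := y)) -` ?E = {b. \<forall>i<k. b i = f w i}"
      using assms(3) by auto
    then show ?thesis
      using prob_random_bits_agree[of k "f w"]
      by (simp add: measure_pmf.emeasure_eq_measure)
  qed
  ultimately have "emeasure (random_sequences G k) ?E = ennreal ((1/2) ^ k)"
    \<comment> \<open>The inner measure must stay in the form just computed; being the same for
      every \<open>f\<close>, it is also the average over \<open>f\<close>.\<close>
    by (simp del: emeasure_map_pmf)
  then show ?thesis
    by (simp add: measure_def)
qed

section \<open>What a node hears in one slot\<close>

lemma emulateB_action_eq_Beep:
  "emulateB_action bits i t = Beep \<longleftrightarrow> bits i = (t = Slot1)"
  by (cases t) auto

lemma emulation_action_eq_Beep: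
  "emulation_action B s i t v = Beep \<longleftrightarrow> v \<in> B \<and> s v i = (t = Slot1)"
  by (simp add: emulation_action_def emulateL_action_def emulateB_action_eq_Beep)

text \<open>Coding the slot as the truth value of \<open>t = Slot1\<close> treats both slots by one
  equation between bits; cases on \<open>t\<close> are split afterwards only by
  \<open>all_slot\<close> and \<open>ex_slot\<close>.\<close>

lemma emulation_feedback_eq_Some_True:
  "emulation_feedback G B s v i t = Some True \<longleftrightarrow>
     (v \<in> B \<longrightarrow> s v i \<noteq> (t = Slot1)) \<and> (\<exists>u\<in>neighbours G v \<inter> B. s u i = (t = Slot1))"
proof -
  have "emulation_feedback G B s v i t = Some True \<longleftrightarrow>
      emulation_action B s i t v \<noteq> Beep \<and> (\<exists>u\<in>neighbours G v. emulation_action B s i t u = Beep)"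
    by (simp add: emulation_feedback_def BL_feedback_def)
  then show ?thesis
    unfolding emulation_action_eq_Beep by blast
qed

lemma all_slot: "(\<forall>t. P t) \<longleftrightarrow> P Slot1 \<and> P Slot2"
  using slot.induct[of P] by blast

lemma ex_slot: "(\<exists>t. P t) \<longleftrightarrow> P Slot1 \<or> P Slot2"
  using all_slot[of "\<lambda>t. \<not> P t"] by blast

text \<open>Besides finiteness of neighbourhoods, this makes \<open>v\<close> and a neighbour a pair
  of distinct nodes, as \<open>prob_random_sequences_agree\<close> demands.\<close>

lemma neighbours_subset_pverts:
  assumes "pair_graph G"
  shows "neighbours G v \<subseteq> pverts G - {v}"
proof -
  interpret pair_graph G by fact
  show ?thesis
    using in_arcsD2 pair_no_loops by (fastforce simp: neighbours_def)
qed

section \<open>Failure forces two strings to agree\<close>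

text \<open>In a sub-phase where the bits differ, \<open>u\<close> beeps in the very slot in which
  \<open>v\<close> listens.\<close>

lemma emulateB_correct_or_agree:
  assumes "v \<in> B" "u \<in> neighbours G v \<inter> B"
  shows "emulateB_correct G B k s v \<or> (\<forall>i<k. s v i = s u i)"
proof (rule disjCI)
  assume "\<not> (\<forall>i<k. s v i = s u i)"
  then obtain i where "i < k" "s u i \<noteq> s v i"
    by metis
  then have "emulateB_collision k (emulation_feedback G B s v)"
    unfolding emulateB_collision_def emulation_feedback_eq_Some_True ex_slot
    using assms by (intro exI[of _ i]) auto
  then show "emulateB_correct G B k s v"
    using assms by (auto simp: emulateB_correct_def)
qed

lemma emulateB_correct_no_beep:
  assumes "neighbours G v \<inter> B = {}"
  shows "emulateB_correct G B k s v"
  unfolding emulateB_correct_def emulateB_collision_def emulation_feedback_eq_Some_True assms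
  using assms by blast

text \<open>Whatever its bit, a beeping neighbour beeps in one slot of each sub-phase, so sub-phase
  0 alone reveals it with certainty.\<close>

lemma emulateL_beep_iff:
  assumes "v \<notin> B" "k > 0"
  shows "emulateL_beep k (emulation_feedback G B s v) \<longleftrightarrow> (\<exists>u\<in>neighbours G v. u \<in> B)"
proof
  assume "\<exists>u\<in>neighbours G v. u \<in> B"
  then obtain u where "u \<in> neighbours G v \<inter> B"
    by blast
  then have "\<exists>t. emulation_feedback G B s v 0 t = Some True"
    unfolding emulation_feedback_eq_Some_True ex_slot using assms(1) by (cases "s u 0") auto
  then show "emulateL_beep k (emulation_feedback G B s v)"
    using assms(2) unfolding emulateL_beep_def by blast
qed (auto simp: emulateL_beep_def emulation_feedback_eq_Some_True)

lemma emulateL_collision_iff: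
  assumes "v \<notin> B"
  shows "emulateL_collision k (emulation_feedback G B s v) \<longleftrightarrow>
    (\<exists>i<k. \<exists>u\<in>neighbours G v \<inter> B. \<exists>w\<in>neighbours G v \<inter> B. s u i \<and> \<not> s w i)"
proof -
  have "(\<forall>t. emulation_feedback G B s v i t = Some True) \<longleftrightarrow>
      (\<exists>u\<in>neighbours G v \<inter> B. s u i) \<and> (\<exists>w\<in>neighbours G v \<inter> B. \<not> s w i)" for i
    unfolding emulation_feedback_eq_Some_True all_slot using assms by simp
  then show ?thesis
    unfolding emulateL_collision_def by blast
qed

text \<open>A lone beeping neighbour has a single bit per sub-phase and cannot fill both slots, so
  false alarms are impossible.\<close>

lemma emulateL_correct_single:
  assumes "v \<notin> B" "k > 0" "finite (neighbours G v)" "\<not> card (neighbours G v \<inter> B) \<ge> 2"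
  shows "emulateL_correct G B k s v"
proof -
  have "u = w" if "u \<in> neighbours G v \<inter> B" "w \<in> neighbours G v \<inter> B" for u w
    using that assms(3,4) card_le_Suc0_iff_eq[of "neighbours G v \<inter> B"] by auto
  then have "\<not> emulateL_collision k (emulation_feedback G B s v)"
    unfolding emulateL_collision_iff[OF assms(1)] by blast
  then show ?thesis
    using assms(4) by (simp add: emulateL_correct_def emulateL_beep_iff[OF assms(1,2)])
qed

lemma emulateL_correct_or_agree:
  assumes "v \<notin> B" "k > 0" "finite (neighbours G v)" "u \<noteq> w"
    "u \<in> neighbours G v \<inter> B" "w \<in> neighbours G v \<inter> B"
  shows "emulateL_correct G B k s v \<or> (\<forall>i<k. s u i = s w i)"
proof (rule disjCI)
  assume "\<not> (\<forall>i<k. s u i = s w i)"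
  then have "emulateL_collision k (emulation_feedback G B s v)"
    unfolding emulateL_collision_iff[OF assms(1)] using assms(5,6) by blast
  moreover have "card (neighbours G v \<inter> B) \<ge> 2"
    using card_mono[of "neighbours G v \<inter> B" "{u, w}"] assms(3-6) by simp
  ultimately show "emulateL_correct G B k s v"
    by (simp add: emulateL_correct_def emulateL_beep_iff[OF assms(1,2)])
qed

text \<open>The pair depends on \<open>G\<close>, \<open>B\<close> and \<open>v\<close> only and
  precedes the quantifier over \<open>s\<close>. Failure at \<open>v\<close> thus lies in one fixed
  agreement event, with no union over pairs of neighbours.\<close>

lemma emulation_correct_or_agree:
  assumes "pair_graph G" "v \<in> pverts G" "k > 0"
  shows "(\<forall>s. emulation_correct G B k s v) \<or>
    (\<exists>u\<in>pverts G. \<exists>w. u \<noteq> w \<and>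
      (\<forall>s. emulation_correct G B k s v \<or> (\<forall>i<k. s u i = s w i)))"
proof -
  interpret pair_graph G by fact
  note N = neighbours_subset_pverts[OF assms(1), of v]
  have fin: "finite (neighbours G v)"
    using N pair_finite_verts finite_subset by blast
  consider
      (B0) "v \<in> B" "neighbours G v \<inter> B = {}"
    | (B1) u where "v \<in> B" "u \<in> neighbours G v \<inter> B"
    | (L1) "v \<notin> B" "\<not> card (neighbours G v \<inter> B) \<ge> 2"
    | (L2) "v \<notin> B" "card (neighbours G v \<inter> B) \<ge> 2"
    by blast
  then show ?thesis
  proof cases
    case B0
    then show ?thesis
      by (simp add: emulation_correct_def emulateB_correct_no_beep)
  next
    case (B1 u)
    then have "v \<noteq> u"
      using N by blast
    then show ?thesis
      using B1 assms(2) emulateB_correct_or_agree[OF B1]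
      by (auto simp: emulation_correct_def intro!: bexI[of _ v] exI[of _ u])
  next
    case L1
    then show ?thesis
      using assms(3) fin by (simp add: emulation_correct_def emulateL_correct_single)
  next
    case L2
    then obtain u w where uw: "u \<noteq> w" "u \<in> neighbours G v \<inter> B" "w \<in> neighbours G v \<inter> B"
      using card_le_Suc0_iff_eq[of "neighbours G v \<inter> B"] fin by fastforce
    moreover have "u \<in> pverts G"
      using uw N by blast
    ultimately show ?thesis
      using L2(1) emulateL_correct_or_agree[OF L2(1) assms(3) fin uw]
      by (auto simp: emulation_correct_def intro!: bexI[of _ u] exI[of _ w])
  qed
qed

section \<open>Failure probability at one node and at all nodes\<close>

lemma prob_incorrect_le:
  assumes "pair_graph G" "v \<in> pverts G"
  shows "measure_pmf.prob (random_sequences G k) {s. \<not> emulation_correct G B k s v} \<le> (1/2) ^ k"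
\<comment> \<open>Without sub-phases a listener misses every beep, but the bound is then 1.\<close>
proof (cases "k = 0")
  case False
  interpret pair_graph G by fact
  from False consider "\<forall>s. emulation_correct G B k s v"
    | u w where "u \<in> pverts G" "u \<noteq> w"
        "\<forall>s. emulation_correct G B k s v \<or> (\<forall>i<k. s u i = s w i)"
    using emulation_correct_or_agree[OF assms, of k B] by blast
  then show ?thesis
  proof cases
    case (2 u w)
    then have "measure_pmf.prob (random_sequences G k) {s. \<not> emulation_correct G B k s v}
        \<le> measure_pmf.prob (random_sequences G k) {s. \<forall>i<k. s u i = s w i}"
      by (intro measure_pmf.finite_measure_mono) auto
    then show ?thesis
      using prob_random_sequences_agree[OF pair_finite_verts 2(1,2)] by simp
  qed simp
qed simp

lemma prob_pmf_compl:
  "measure_pmf.prob p {x. P x} = 1 - measure_pmf.prob p {x. \<not> P x}"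
  using measure_pmf.prob_compl[of "{x. \<not> P x}" p]
  by (simp add: Compl_eq_Diff_UNIV[symmetric] Collect_neg_eq)

lemma prob_correct_at_ge:
  assumes "pair_graph G" "v \<in> pverts G"
  shows "prob_correct_at G B k v \<ge> 1 - (1/2) ^ k"
  using prob_incorrect_le[OF assms] unfolding prob_correct_at_def
  by (subst prob_pmf_compl) simp

lemma prob_correct_everywhere_ge:
  assumes "pair_graph G"
  shows "prob_correct_everywhere G B k \<ge> 1 - real (card (pverts G)) * (1/2) ^ k"
proof -
  interpret pair_graph G by fact
  let ?P = "measure_pmf.prob (random_sequences G k)"
  have "?P {s. \<not> (\<forall>v\<in>pverts G. emulation_correct G B k s v)}
      = ?P (\<Union>v\<in>pverts G. {s. \<not> emulation_correct G B k s v})"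
    by (intro arg_cong[where f = ?P]) auto
  also have "\<dots> \<le> (\<Sum>v\<in>pverts G. ?P {s. \<not> emulation_correct G B k s v})"
    by (intro measure_pmf.finite_measure_subadditive_finite pair_finite_verts) simp
  also have "\<dots> \<le> (\<Sum>v\<in>pverts G. (1/2) ^ k)"
    using assms by (intro sum_mono prob_incorrect_le)
  finally show ?thesis
    unfolding prob_correct_everywhere_def by (subst prob_pmf_compl) simp
qed

section \<open>The three choices of \<open>k\<close>\<close>

text \<open>Truncation by \<open>nat\<close> does no harm when \<open>x\<close> is negative, as
  happens for large \<epsilon>: rounding up to 0 still gives at least \<open>x\<close>.\<close>

lemma half_power_nat_ceiling_le: "(1/2) ^ nat \<lceil>x\<rceil> \<le> (2::real) powr (- x)"
proof -
  have "(1/2) ^ nat \<lceil>x\<rceil> = (2::real) powr (- real (nat \<lceil>x\<rceil>))"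
    by (simp add: powr_minus powr_realpow power_one_over inverse_eq_divide)
  also have "\<dots> \<le> 2 powr (- x)"
    using real_nat_ceiling_ge[of x] by (intro powr_mono) auto
  finally show ?thesis .
qed

text \<open>This serves all three claims: exponent 1 with \<open>1 / \<epsilon>\<close> and with
  \<open>n / \<epsilon>\<close>, and the given \<open>c\<close> with \<open>n\<close>
  itself.\<close>

lemma half_power_nat_ceiling_log_le:
  assumes "x > 0"
  shows "(1/2) ^ nat \<lceil>c * log 2 x\<rceil> \<le> x powr (- c)"
proof -
  have "2 powr (- (c * log 2 x)) = x powr (- c)"
    using assms by (simp add: powr_def log_def)
  then show ?thesis
    using half_power_nat_ceiling_le[of "c * log 2 x"] by simp
qed

theorem lemma2:
  fixes \<epsilon> c :: real
  assumes "\<epsilon> > 0" and "c > 2"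
  shows "(\<forall>n>0. \<forall>(G :: 'v pair_pre_digraph) B. \<forall>v\<in>pverts G.
            pair_graph G \<and> card (pverts G) = n \<and> B \<subseteq> pverts G \<longrightarrow>
            prob_correct_at G B (nat \<lceil>log 2 (1 / \<epsilon>)\<rceil>) v \<ge> 1 - \<epsilon>) \<and>
         (\<forall>n>0. \<forall>(G :: 'v pair_pre_digraph) B.
            pair_graph G \<and> card (pverts G) = n \<and> B \<subseteq> pverts G \<longrightarrow>
            prob_correct_everywhere G B (nat \<lceil>log 2 (real n / \<epsilon>)\<rceil>) \<ge> 1 - \<epsilon>) \<and>
         (\<exists>f :: nat \<Rightarrow> real. f \<in> o(\<lambda>n. 1 / real n) \<and>
            (\<forall>n>0. \<forall>(G :: 'v pair_pre_digraph) B.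
               pair_graph G \<and> card (pverts G) = n \<and> B \<subseteq> pverts G \<longrightarrow>
               prob_correct_everywhere G B (nat \<lceil>c * log 2 (real n)\<rceil>) \<ge> 1 - f n))"
proof (intro conjI exI[of _ "\<lambda>n. real n powr (1 - c)"] allI impI ballI; (elim conjE)?)
  fix n :: nat and G :: "'v pair_pre_digraph" and B v
  assume "pair_graph G" "v \<in> pverts G"
  moreover have "(1/2) ^ nat \<lceil>log 2 (1 / \<epsilon>)\<rceil> \<le> \<epsilon>"
    using half_power_nat_ceiling_log_le[of "1 / \<epsilon>" 1] assms(1) by (simp add: powr_minus)
  ultimately show "prob_correct_at G B (nat \<lceil>log 2 (1 / \<epsilon>)\<rceil>) v \<ge> 1 - \<epsilon>"
    using prob_correct_at_ge[of G v "nat \<lceil>log 2 (1 / \<epsilon>)\<rceil>" B] by linarith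
next
  fix n :: nat and G :: "'v pair_pre_digraph" and B
  let ?k = "nat \<lceil>log 2 (real n / \<epsilon>)\<rceil>"
  assume n: "n > 0" "card (pverts G) = n" and "pair_graph G"
  moreover have "(1/2) ^ ?k \<le> \<epsilon> / n"
    using half_power_nat_ceiling_log_le[of "n / \<epsilon>" 1] assms(1) n by (simp add: powr_minus)
  then have "real n * (1/2) ^ ?k \<le> \<epsilon>"
    using n(1) by (simp add: field_simps)
  ultimately show "prob_correct_everywhere G B ?k \<ge> 1 - \<epsilon>"
    using prob_correct_everywhere_ge[of G ?k B] by simp
next
  \<comment> \<open>The witness is the union bound \<open>n * n powr (- c)\<close>; since
    \<open>c > 2\<close>, its exponent \<open>1 - c\<close> is below -1.\<close>
  show "(\<lambda>n. real n powr (1 - c)) \<in> o(\<lambda>n. 1 / real n)"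
    using assms(2) by real_asymp
next
  fix n :: nat and G :: "'v pair_pre_digraph" and B
  let ?k = "nat \<lceil>c * log 2 (real n)\<rceil>"
  assume n: "n > 0" "card (pverts G) = n" and "pair_graph G"
  moreover have "real n * (1/2) ^ ?k \<le> real n * real n powr (- c)"
    using n(1) by (intro mult_left_mono half_power_nat_ceiling_log_le) auto
  moreover have "real n * real n powr (- c) = real n powr (1 - c)"
    using n(1) by (simp add: powr_diff powr_minus field_simps)
  ultimately show "prob_correct_everywhere G B ?k \<ge> 1 - real n powr (1 - c)"
    using prob_correct_everywhere_ge[of G ?k B] by simp
qed

end
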